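(* Let $\{(\bm{x}^{(k)},\alpha^{(k)})\}_{k\ge0}$ be generated by the prox-linear Dinkelbach scheme described in the context, and suppose that assumptions (i)--(iv) of the context hold. Then every cluster point $\bar{\bm{x}}$ of $\{\bm{x}^{(k)}\}$ satisfies $$\bm{0}\in\partial h(\bar{\bm{x}})-\bar\alpha\nabla s(\bar{\bm{x}}),\qquad\bar\alpha:=\frac{\|\bar{\bm{x}}\|_p^p}{\|\bar{\bm{x}}\|_q^p}.$$ Equivalently, $$\bm{0}\in\|\bar{\bm{x}}\|_q^p\,\partial h(\bar{\bm{x}})-\|\bar{\bm{x}}\|_p^p\,\nabla s(\bar{\bm{x}}).$$ Hence every cluster point is a limiting critical point of the constrained ratio problem $\inf\{\|\bm{x}\|_p^p/\|\bm{x}\|_q^p:\bm{A}\bm{x}=\bm{b}\}$.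
   Context: Let $\bm{A}\in\mathbb{R}^{m\times n}$, $\bm{b}\in\mathbb{R}^m$, $\mathcal{F}:=\{\bm{x}\in\mathbb{R}^n:\bm{A}\bm{x}=\bm{b}\}$, $\|\bm{x}\|_r:=(\sum_i|x_i|^r)^{1/r}$ for $0<r<\infty$, $s(\bm{x}):=\|\bm{x}\|_q^p$, and $h(\bm{x}):=\|\bm{x}\|_p^p+I_{\mathcal{F}}(\bm{x})$, where $I_{\mathcal{F}}$ is $0$ on $\mathcal{F}$ and $+\infty$ elsewhere. Scheme: start from $\bm{x}^{(0)}\in\mathcal{F}$ and $\alpha^{(0)}:=\|\bm{x}^{(0)}\|_p^p/\|\bm{x}^{(0)}\|_q^p$, with proximal parameter $\beta>0$. For $k=0,1,2,\dots$ set $\bm{c}^{(k)}:=\alpha^{(k)}\nabla s(\bm{x}^{(k)})=\alpha^{(k)}p\|\bm{x}^{(k)}\|_q^{p-q}\operatorname{sign}(\bm{x}^{(k)})\odot|\bm{x}^{(k)}|^{q-1}$ (entrywise operations), choose $$\bm{x}^{(k+1)}\in\arg\min_{\bm{x}\in\mathbb{R}^n}\left\{h(\bm{x})-\langle\bm{c}^{(k)},\bm{x}\rangle+\tfrac\beta2\|\bm{x}-\bm{x}^{(k)}\|_2^2\right\},$$ and set $\alpha^{(k+1)}:=\|\bm{x}^{(k+1)}\|_p^p/\|\bm{x}^{(k+1)}\|_q^p$. Assumptions: (i) $\mathcal{F}\ne\emptyset$, $0<p\le1$, $q>1$, $\bm{b}\ne\bm{0}$, and $\bm{A}$ has full row rank.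 (ii) The sequence $\{\bm{x}^{(k)}\}$ is bounded. (iii) There exist a compact set $\Omega\subset\mathbb{R}^n$ and an open convex set $\mathcal{U}\subset\mathbb{R}^n$ with $\Omega\subset\mathcal{U}$, $\bm{x}^{(k)}\in\Omega\cap\mathcal{F}$ for all $k$, and $\nabla s$ is $L_s$-Lipschitz on $\mathcal{U}$: $\|\nabla s(\bm{x})-\nabla s(\bm{y})\|_2\le L_s\|\bm{x}-\bm{y}\|_2$ for all $\bm{x},\bm{y}\in\mathcal{U}$. (iv) $\beta>\overline\alpha L_s$, where $\overline\alpha:=n^{1-p/q}$. Subdifferentials: for a proper closed $f:\mathbb{R}^n\to(-\infty,+\infty]$ and $\bm{x}\in\operatorname{dom}f$, the regular (Fr\'echet) subdifferential is $\hat\partial f(\bm{x}):=\{\bm{v}:\liminf_{\bm{y}\to\bm{x},\bm{y}\ne\bm{x}}\frac{f(\bm{y})-f(\bm{x})-\langle\bm{v},\bm{y}-\bm{x}\rangle}{\|\bm{y}-\bm{x}\|}\ge0\}$, and the limiting subdifferential is $\partial f(\bm{x}):=\{\bm{v}:\exists\,\bm{x}^j\to\bm{x},\ f(\bm{x}^j)\to f(\bm{x}),\ \bm{v}^j\in\hat\partial f(\bm{x}^j),\ \bm{v}^j\to\bm{v}\}$. A point $\bm{x}^*\in\operatorname{dom}f$ is a (limiting) critical point of $f$ if $\bm{0}\in\partial f(\bm{x}^* )$; a limiting critical point of the constrained ratio problem is a critical point of the function equal to $\|\bm{x}\|_p^p/\|\bm{x}\|_q^p$ on $\mathcal{F}$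 and $+\infty$ elsewhere. *)

theory Defs
  imports "HOL-Analysis.Analysis"
begin

definition lr_norm :: "real \<Rightarrow> real ^ 'n \<Rightarrow> real" where
  "lr_norm r x = (\<Sum>i\<in>UNIV. \<bar>x $ i\<bar> powr r) powr (1 / r)"

definition feasible_set :: "real ^ 'n ^ 'm \<Rightarrow> real ^ 'm \<Rightarrow> (real ^ 'n) set" where
  "feasible_set A b = {x. A *v x = b}"

definition s_fun :: "real \<Rightarrow> real \<Rightarrow> real ^ 'n \<Rightarrow> real" where
  "s_fun p q x = lr_norm q x powr p"

definition set_indicator :: "'a set \<Rightarrow> 'a \<Rightarrow> ereal" where
  "set_indicator S x = (if x \<in> S then 0 else \<infinity>)"

definition h_fun :: "real ^ 'n ^ 'm \<Rightarrow> real ^ 'm \<Rightarrow> real \<Rightarrow> real ^ 'n \<Rightarrow> ereal" where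
  "h_fun A b p x = ereal (lr_norm p x powr p) + set_indicator (feasible_set A b) x"

definition lr_ratio :: "real \<Rightarrow> real \<Rightarrow> real ^ 'n \<Rightarrow> real" where
  "lr_ratio p q x = lr_norm p x powr p / lr_norm q x powr p"

definition constrained_ratio ::
    "real ^ 'n ^ 'm \<Rightarrow> real ^ 'm \<Rightarrow> real \<Rightarrow> real \<Rightarrow> real ^ 'n \<Rightarrow> ereal" where
  "constrained_ratio A b p q x =
     (if x \<in> feasible_set A b then ereal (lr_ratio p q x) else \<infinity>)"

text \<open>The value is meaningful only where \<open>f\<close> is differentiable.\<close>

definition grad :: "('a::real_inner \<Rightarrow> real) \<Rightarrow> 'a \<Rightarrow> 'a" where
  "grad f x = (THE D. GDERIV f x :> D)"

text \<open>The prox-linear Dinkelbach scheme. Every choice of minimiser in the argmin step is allowed;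
  the minimisation ranges over the whole space, the constraint being encoded in \<open>h_fun\<close>.
  The gradient is given by the closed formula of lemma \<open>grad_s_fun\<close> below.\<close>

definition prox_linear_dinkelbach ::
    "real ^ 'n ^ 'm \<Rightarrow> real ^ 'm \<Rightarrow> real \<Rightarrow> real \<Rightarrow> real \<Rightarrow>
     (nat \<Rightarrow> real ^ 'n) \<Rightarrow> (nat \<Rightarrow> real) \<Rightarrow> bool" where
  "prox_linear_dinkelbach A b p q \<beta> x \<alpha> \<longleftrightarrow>
     x 0 \<in> feasible_set A b \<and> \<alpha> 0 = lr_ratio p q (x 0) \<and>
     (\<forall>k. let c = \<alpha> k *\<^sub>R grad (s_fun p q) (x k) in
        is_arg_min
          (\<lambda>y. h_fun A b p y - ereal (c \<bullet> y) + ereal (\<beta> / 2 * (norm (y - x k))\<^sup>2))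
          (\<lambda>_. True) (x (Suc k)) \<and>
        \<alpha> (Suc k) = lr_ratio p q (x (Suc k)))"

definition eff_domain :: "('a \<Rightarrow> ereal) \<Rightarrow> 'a set" where
  "eff_domain f = {x. f x < \<infinity>}"

text \<open>For \<open>f\<close> never equal to \<open>-\<infinity>\<close>, the differences below involve no \<open>\<infinity> - \<infinity>\<close>, since
  \<open>f x\<close> is finite on the effective domain; outside of it both subdifferentials are empty.\<close>

definition regular_subdifferential :: "('a::real_inner \<Rightarrow> ereal) \<Rightarrow> 'a \<Rightarrow> 'a set" where
  "regular_subdifferential f x =
     {v. x \<in> eff_domain f \<and>
         Liminf (at x) (\<lambda>y. (f y - f x - ereal (v \<bullet> (y - x))) / ereal (norm (y - x))) \<ge> 0}"

definition limiting_subdifferential :: "('a::real_inner \<Rightarrow> ereal) \<Rightarrow> 'a \<Rightarrow> 'a set" where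
  "limiting_subdifferential f x =
     {v. x \<in> eff_domain f \<and>
         (\<exists>xs vs. xs \<longlonglongrightarrow> x \<and> (\<lambda>j. f (xs j)) \<longlonglongrightarrow> f x \<and>
            (\<forall>j. vs j \<in> regular_subdifferential f (xs j)) \<and> vs \<longlonglongrightarrow> v)}"

definition limiting_critical_point :: "('a::real_inner \<Rightarrow> ereal) \<Rightarrow> 'a \<Rightarrow> bool" where
  "limiting_critical_point f x \<longleftrightarrow> x \<in> eff_domain f \<and> 0 \<in> limiting_subdifferential f x"

definition cluster_point :: "(nat \<Rightarrow> 'a::topological_space) \<Rightarrow> 'a \<Rightarrow> bool" where
  "cluster_point x l \<longleftrightarrow> (\<exists>r. strict_mono r \<and> (x \<circ> r) \<longlonglongrightarrow> l)"

lemma gradI: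
  assumes "GDERIV f x :> D"
  shows "grad f x = D"
  unfolding grad_def
proof (rule the_equality[where a = D])
  show "GDERIV f x :> D" by fact
next
  fix E assume "GDERIV f x :> E"
  then have "(\<lambda>h. inner h E) = (\<lambda>h. inner h D)"
    using assms unfolding gderiv_def by (rule has_derivative_unique)
  then have "inner (E - D) E = inner (E - D) D" by (rule fun_cong)
  then have "inner (E - D) (E - D) = 0" by (simp add: inner_diff_right)
  then show "E = D" by simp
qed

lemma has_real_derivative_abs_powr:
  fixes q t :: real
  assumes "q > 1"
  shows "((\<lambda>t. \<bar>t\<bar> powr q) has_real_derivative q * (sgn t * \<bar>t\<bar> powr (q - 1))) (at t)"
proof -
  consider "t > 0" | "t < 0" | "t = 0" by linarith
  then show ?thesis
  proof cases
    case 1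
    have "((\<lambda>t. t powr q) has_real_derivative q * t powr (q - 1)) (at t)"
      using 1 by (rule has_real_derivative_powr)
    then have "((\<lambda>t. \<bar>t\<bar> powr q) has_real_derivative q * t powr (q - 1)) (at t)"
      by (rule has_field_derivative_transform_within_open[where S = "{0<..}"]) (use 1 in auto)
    then show ?thesis using 1 by simp
  next
    case 2
    have "((\<lambda>t. (- t) powr q) has_real_derivative - (q * (- t) powr (q - 1))) (at t)"
      using 2 by (auto intro!: derivative_eq_intros simp: powr_diff)
    then have "((\<lambda>t. \<bar>t\<bar> powr q) has_real_derivative - (q * (- t) powr (q - 1))) (at t)"
      by (rule has_field_derivative_transform_within_open[where S = "{..<0}"]) (use 2 in auto)
    then show ?thesis using 2 by simp
  next
    case 3
    have "((\<lambda>h. \<bar>h\<bar> powr (q - 1)) \<longlongrightarrow> \<bar>0\<bar> powr (q - 1)) (at (0::real))"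
      using assms by (intro tendsto_powr' tendsto_intros) auto
    then have "((\<lambda>h. \<bar>h\<bar> powr (q - 1)) \<longlongrightarrow> 0) (at (0::real))" using assms by simp
    then have "((\<lambda>h. \<bar>h\<bar> powr q / h) \<longlongrightarrow> 0) (at (0::real))"
    proof (rule Lim_null_comparison[rotated])
      show "\<forall>\<^sub>F h in at (0::real). norm (\<bar>h\<bar> powr q / h) \<le> \<bar>h\<bar> powr (q - 1)"
        by (auto simp: eventually_at_filter powr_diff abs_divide)
    qed
    then show ?thesis using 3 assms by (simp add: has_field_derivative_iff)
  qed
qed

lemma GDERIV_s_fun:
  fixes x :: "real ^ 'n"
  assumes q: "q > 1" and x: "x \<noteq> 0"
  shows "GDERIV (s_fun p q) x :>
    (p * lr_norm q x powr (p - q)) *\<^sub>R (\<chi> i. sgn (x $ i) * \<bar>x $ i\<bar> powr (q - 1))"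
proof -
  define S where "S = (\<lambda>y :: real ^ 'n. \<Sum>i\<in>UNIV. \<bar>y $ i\<bar> powr q)"
  define d where "d = (\<lambda>i. q * (sgn (x $ i) * \<bar>x $ i\<bar> powr (q - 1)))"
  obtain j where j: "x $ j \<noteq> 0" using x by (auto simp: vec_eq_iff)
  have "0 < \<bar>x $ j\<bar> powr q" using j by simp
  also have "\<dots> \<le> S x" unfolding S_def by (rule member_le_sum) auto
  finally have Spos: "S x > 0" .
  have comp: "((\<lambda>y :: real ^ 'n. \<bar>y $ i\<bar> powr q) has_derivative (\<lambda>h. d i * h $ i)) (at x)" for i
  proof -
    have "((\<lambda>t. \<bar>t\<bar> powr q) has_derivative (*) (d i)) (at (x $ i))"
      using has_real_derivative_abs_powr[OF q, of "x $ i"]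
      by (simp add: d_def has_field_derivative_def)
    then show ?thesis
      using has_derivative_compose[OF bounded_linear_imp_has_derivative[OF bounded_linear_vec_nth]]
      by blast
  qed
  have "(S has_derivative (\<lambda>h. \<Sum>i\<in>UNIV. d i * h $ i)) (at x)"
    unfolding S_def by (intro has_derivative_sum comp)
  then have G: "GDERIV S x :> (\<chi> i. d i)"
    by (simp add: gderiv_def inner_vec_def mult.commute)
  have "((\<lambda>t. t powr (p / q)) has_real_derivative p / q * S x powr (p / q - 1)) (at (S x))"
    using Spos by (rule has_real_derivative_powr)
  from GDERIV_DERIV_compose[OF G this]
  have 1: "GDERIV (\<lambda>y. S y powr (p / q)) x :> (p / q * S x powr (p / q - 1)) *\<^sub>R (\<chi> i. d i)" .
  have 2: "(\<lambda>y. S y powr (p / q)) = s_fun p q"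
    by (simp add: fun_eq_iff s_fun_def lr_norm_def S_def powr_powr)
  have "lr_norm q x powr (p - q) = S x powr (p / q - 1)"
    using q by (simp add: lr_norm_def S_def powr_powr diff_divide_distrib)
  then have 3: "(p / q * S x powr (p / q - 1)) *\<^sub>R (\<chi> i. d i) =
    (p * lr_norm q x powr (p - q)) *\<^sub>R (\<chi> i. sgn (x $ i) * \<bar>x $ i\<bar> powr (q - 1))"
    using q by (simp add: vec_eq_iff d_def)
  show ?thesis using 1 unfolding 2 3 .
qed

lemma grad_s_fun:
  fixes x :: "real ^ 'n"
  assumes "q > 1" and "x \<noteq> 0"
  shows "grad (s_fun p q) x =
    (p * lr_norm q x powr (p - q)) *\<^sub>R (\<chi> i. sgn (x $ i) * \<bar>x $ i\<bar> powr (q - 1))"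
  using GDERIV_s_fun[OF assms] by (rule gradI)

end

(* Write P for the p-th power of the p-quasinorm, so that h = P on the feasible set F and P = alpha s
   along the iterates, where the power mean inequality bounds alpha_k by n^(1 - p/q).  Comparing
   x_(k+1) with x_k in the proximal subproblem and bounding s from below by its linearisation minus
   L/2 |x_(k+1) - x_k|^2 yields
     (beta - n^(1 - p/q) L) / 2 * |x_(k+1) - x_k|^2 <= (alpha_k - alpha_(k+1)) s(x_(k+1)).
   Hence alpha_k decreases and the steps tend to 0, because s is bounded on Omega.  Optimality of
   x_(k+1) makes v_k = alpha_k grad s(x_k) - beta (x_(k+1) - x_k) a regular subgradient of h at
   x_(k+1), and along a subsequence v_k tends to alphabar grad s(xbar).  A quotient rule for regular
   subgradients turns v_k into regular subgradients of the ratio at x_(k+1), which tend to 0. *)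

theory Submission
  imports Defs
begin

section \<open>Power sums and the upper bound on the ratio\<close>

lemma lr_norm_powr_self:
  fixes x :: "real ^ 'n"
  assumes "r > 0"
  shows "lr_norm r x powr r = (\<Sum>i\<in>UNIV. \<bar>x $ i\<bar> powr r)"
  using assms by (simp add: lr_norm_def powr_powr sum_nonneg)

lemma lr_norm_pos:
  fixes x :: "real ^ 'n"
  assumes "x \<noteq> 0"
  shows "lr_norm r x > 0"
proof -
  obtain j where "x $ j \<noteq> 0" using assms by (auto simp: vec_eq_iff)
  then have "0 < \<bar>x $ j\<bar> powr r" by simp
  also have "\<dots> \<le> (\<Sum>i\<in>UNIV. \<bar>x $ i\<bar> powr r)" by (rule member_le_sum) auto
  finally show ?thesis by (simp add: lr_norm_def)
qed

lemma tendsto_lr_norm_powr_self: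
  fixes x :: "real ^ 'n"
  assumes "r > 0" and "(f \<longlongrightarrow> x) F"
  shows "((\<lambda>k. lr_norm r (f k) powr r) \<longlongrightarrow> lr_norm r x powr r) F"
  unfolding lr_norm_powr_self[OF assms(1)]
  using assms by (intro tendsto_sum tendsto_powr' tendsto_rabs tendsto_vec_nth tendsto_const) auto

text \<open>Power mean inequality, obtained by weighted Young with weights p/q and 1 - p/q. It gives
  the uniform bound on the ratios that makes the condition on the proximal parameter sufficient for
  descent.\<close>

lemma lr_norm_powr_le:
  fixes x :: "real ^ 'n"
  assumes p: "0 < p" and pq: "p \<le> q" and x: "x \<noteq> 0"
  shows "lr_norm p x powr p \<le> real CARD('n) powr (1 - p / q) * lr_norm q x powr p"
proof -
  define N where "N = real CARD('n)"
  define S where "S = (\<Sum>i\<in>UNIV. \<bar>x $ i\<bar> powr q)"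
  define r where "r = p / q"
  have q: "q > 0" using p pq by simp
  have N: "N > 0" by (simp add: N_def)
  have S: "S > 0"
    unfolding S_def lr_norm_powr_self[OF q, symmetric] using lr_norm_pos[OF x, of q] by simp
  have r: "0 \<le> r" "r \<le> 1" using p pq by (auto simp: r_def)
  \<comment> \<open>Each entry is compared with the mean \<open>S / N\<close> of the q-th powers.
    Young is an equality when all entries agree in modulus, so summation loses nothing in the
    constant.\<close>
  have young: "\<bar>x $ i\<bar> powr p * (S / N) powr (1 - r) \<le> r * \<bar>x $ i\<bar> powr q + (1 - r) * (S / N)" for i
  proof (cases "x $ i = 0")
    case True
    then show ?thesis using r S N by simp
  next
    case False
    have "(\<bar>x $ i\<bar> powr q) powr r = \<bar>x $ i\<bar> powr p"
      using q by (simp add: powr_powr r_def)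
    then show ?thesis
      using Youngs_inequality_0[of r "1 - r" "\<bar>x $ i\<bar> powr q" "S / N"] r False S N by simp
  qed
  have "(\<Sum>i\<in>UNIV. \<bar>x $ i\<bar> powr p) * (S / N) powr (1 - r)
      \<le> (\<Sum>i\<in>(UNIV :: 'n set). r * \<bar>x $ i\<bar> powr q + (1 - r) * (S / N))"
    unfolding sum_distrib_right by (intro sum_mono young)
  also have "\<dots> = r * S + N * ((1 - r) * (S / N))"
    by (simp add: sum.distrib sum_distrib_left S_def N_def)
  also have "\<dots> = S"
    using N by (simp add: field_simps)
  also have "\<dots> = (N powr (1 - r) * S powr r) * (S / N) powr (1 - r)"
    using S N by (simp add: powr_divide flip: powr_add)
  finally have "(\<Sum>i\<in>UNIV. \<bar>x $ i\<bar> powr p) \<le> N powr (1 - r) * S powr r"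
    using S N by simp
  moreover have "S powr r = lr_norm q x powr p"
    using q by (simp add: S_def lr_norm_def powr_powr r_def)
  ultimately show ?thesis
    by (simp add: lr_norm_powr_self[OF p] N_def r_def)
qed

lemma h_fun_eq:
  "h_fun A b p = (\<lambda>x. if x \<in> feasible_set A b then ereal (lr_norm p x powr p) else \<infinity>)"
  by (simp add: fun_eq_iff h_fun_def set_indicator_def)

lemma closed_feasible_set: "closed (feasible_set A b)"
  unfolding feasible_set_def by (intro closed_Collect_eq continuous_intros)

section \<open>Gradients and the quadratic lower bound\<close>

text \<open>In finite dimension the derivative is the inner product with its adjoint at 1 (Riesz),
  so the description in \<open>grad\<close> denotes an actual gradient.\<close>

lemma GDERIV_grad:
  fixes f :: "'a::euclidean_space \<Rightarrow> real"
  assumes "f differentiable (at x)"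
  shows "GDERIV f x :> grad f x"
proof -
  obtain f' where f': "(f has_derivative f') (at x)"
    using assms by (auto simp: differentiable_def)
  have "f' h = h \<bullet> adjoint f' 1" for h
    using adjoint_works[OF has_derivative_linear[OF f'], of h 1] by simp
  then obtain D where "f' = (\<lambda>h. h \<bullet> D)" by blast
  with f' have "GDERIV f x :> D" by (simp add: gderiv_def)
  then show ?thesis using gradI by metis
qed

lemma quadratic_lower_bound_of_Lipschitz_gradient:
  fixes f :: "'a::real_inner \<Rightarrow> real"
  assumes U: "convex U" "x \<in> U" "y \<in> U"
    and G: "\<And>z. z \<in> U \<Longrightarrow> GDERIV f z :> G z"
    and lip: "\<And>z w. z \<in> U \<Longrightarrow> w \<in> U \<Longrightarrow> norm (G z - G w) \<le> L * norm (z - w)"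
  shows "f x + G x \<bullet> (y - x) - L / 2 * (norm (y - x))\<^sup>2 \<le> f y"
proof -
  define d where "d = y - x"
  \<comment> \<open>Up to a constant, \<open>\<phi>\<close> is the gap between f and its
    linearisation along the segment, plus the quadratic term. Cauchy-Schwarz and the Lipschitz bound
    make its derivative nonnegative.\<close>
  define \<phi> where "\<phi> t = f (x + t *\<^sub>R d) + L / 2 * t\<^sup>2 * (norm d)\<^sup>2 - t * (G x \<bullet> d)" for t
  have "\<phi> 0 \<le> \<phi> 1"
  proof (rule DERIV_nonneg_imp_nondecreasing[where f = \<phi>])
    fix t :: real assume t: "0 \<le> t" "t \<le> 1"
    have "x + t *\<^sub>R d = (1 - t) *\<^sub>R x + t *\<^sub>R y" by (simp add: d_def algebra_simps)
    then have inU: "x + t *\<^sub>R d \<in> U" using t convexD_alt[OF U] by simp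
    have "((\<lambda>t. x + t *\<^sub>R d) has_derivative (\<lambda>h. h *\<^sub>R d)) (at t)"
      by (auto intro!: derivative_eq_intros)
    from has_derivative_compose[OF this G[OF inU, unfolded gderiv_def]]
    have fd: "((\<lambda>t. f (x + t *\<^sub>R d)) has_real_derivative G (x + t *\<^sub>R d) \<bullet> d) (at t)"
      by (simp add: has_field_derivative_def inner_commute mult.commute[of _ "_ \<bullet> _"])
    have "(\<phi> has_real_derivative G (x + t *\<^sub>R d) \<bullet> d + L * t * (norm d)\<^sup>2 - G x \<bullet> d) (at t)"
      unfolding \<phi>_def by (rule derivative_eq_intros fd refl | simp)+
    moreover have "0 \<le> G (x + t *\<^sub>R d) \<bullet> d + L * t * (norm d)\<^sup>2 - G x \<bullet> d"
    proof -
      have "(G x - G (x + t *\<^sub>R d)) \<bullet> d \<le> norm (G x - G (x + t *\<^sub>R d)) * norm d"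
        by (rule norm_cauchy_schwarz)
      also have "\<dots> \<le> (L * norm (x - (x + t *\<^sub>R d))) * norm d"
        by (intro mult_right_mono lip inU U) simp
      finally show ?thesis using t by (simp add: inner_diff_left power2_eq_square)
    qed
    ultimately show "\<exists>D. DERIV \<phi> t :> D \<and> D \<ge> 0" by blast
  qed simp
  then show ?thesis by (simp add: \<phi>_def d_def)
qed

section \<open>Regular and limiting subgradients\<close>

lemma limiting_subdifferentialI:
  assumes "x \<in> eff_domain f" and "xs \<longlonglongrightarrow> x" and "(\<lambda>j. f (xs j)) \<longlonglongrightarrow> f x"
    and "\<And>j. vs j \<in> regular_subdifferential f (xs j)" and "vs \<longlonglongrightarrow> v"
  shows "v \<in> limiting_subdifferential f x"
  using assms unfolding limiting_subdifferential_def by blast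

text \<open>Replaces the extended-real liminf by a real first-order minorant with error e times the
  distance. Only points of S matter, because the difference quotient is infinite elsewhere.\<close>

lemma regular_subdifferential_restrictI:
  fixes g :: "'a::real_inner \<Rightarrow> real"
  assumes x: "x \<in> S"
    and ev: "\<And>e. e > 0 \<Longrightarrow>
      \<forall>\<^sub>F y in at x. y \<in> S \<longrightarrow> g x + v \<bullet> (y - x) - e * norm (y - x) \<le> g y"
  shows "v \<in> regular_subdifferential (\<lambda>y. if y \<in> S then ereal (g y) else \<infinity>) x"
  unfolding regular_subdifferential_def mem_Collect_eq le_Liminf_iff
proof (intro conjI allI impI)
  show "x \<in> eff_domain (\<lambda>y. if y \<in> S then ereal (g y) else \<infinity>)"
    using x by (simp add: eff_domain_def)
next
  fix c :: ereal assume "c < 0"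
  then obtain e where e: "e > 0" "c < ereal (- e)"
    using ereal_dense2[of c 0] by (metis ereal_less(2) neg_0_less_iff_less minus_minus zero_ereal_def less_ereal.simps(1))
  show "\<forall>\<^sub>F y in at x. c < ((if y \<in> S then ereal (g y) else \<infinity>) -
      (if x \<in> S then ereal (g x) else \<infinity>) - ereal (v \<bullet> (y - x))) / ereal (norm (y - x))"
    using ev[OF e(1)] eventually_neq_at_within[of x x UNIV]
  proof eventually_elim
    case (elim y)
    then have n: "norm (y - x) > 0" by simp
    show ?case
    proof (cases "y \<in> S")
      case True
      with elim n have "- e \<le> (g y - g x - v \<bullet> (y - x)) / norm (y - x)"
        by (simp add: field_simps)
      then show ?thesis using e True x n
        by (simp add: order.strict_trans2)
    next
      case False
      then show ?thesis using e x n by (auto simp: ereal_divide_eq less_top[symmetric])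
    qed
  qed
qed

text \<open>Locally, the numerator is at least its affine minorant up to \<open>o(norm (y - x))\<close>; the quotient of
  this affine function by \<open>s\<close> is differentiable, with the asserted gradient.\<close>

lemma regular_subgradient_quotient:
  fixes g s :: "'a::real_inner \<Rightarrow> real"
  assumes ev: "\<And>e. e > 0 \<Longrightarrow>
      \<forall>\<^sub>F y in at x. y \<in> S \<longrightarrow> g x + v \<bullet> (y - x) - e * norm (y - x) \<le> g y"
    and s: "GDERIV s x :> G" and pos: "s x > 0" and e: "e > 0"
  defines "w \<equiv> (1 / s x) *\<^sub>R (v - (g x / s x) *\<^sub>R G)"
  shows "\<forall>\<^sub>F y in at x. y \<in> S \<longrightarrow>
    g x / s x + w \<bullet> (y - x) - e * norm (y - x) \<le> g y / s y"
proof -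
  define \<phi> where "\<phi> y = (g x + v \<bullet> (y - x)) * inverse (s y)" for y
  have "GDERIV (\<lambda>y. g x + v \<bullet> (y - x)) x :> v"
    unfolding gderiv_def by (auto intro!: derivative_eq_intros simp: inner_commute)
  from GDERIV_mult[OF this GDERIV_inverse[OF s]] pos
  have "GDERIV \<phi> x :> w"
    unfolding \<phi>_def w_def
    by (simp add: algebra_simps power2_eq_square inverse_eq_divide)
  then have "(\<phi> has_derivative (\<lambda>h. h \<bullet> w)) (at x)" by (simp add: gderiv_def)
  then obtain d where d: "d > 0"
    "\<And>y. norm (y - x) < d \<Longrightarrow> norm (\<phi> y - \<phi> x - (y - x) \<bullet> w) \<le> e / 2 * norm (y - x)"
    using e unfolding has_derivative_at_alt by (meson half_gt_zero)
  have A: "\<forall>\<^sub>F y in at x. norm (\<phi> y - \<phi> x - (y - x) \<bullet> w) \<le> e / 2 * norm (y - x)"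
    using d by (auto simp: eventually_at dist_norm)
  have "(s \<longlongrightarrow> s x) (at x)"
    using s by (auto simp: gderiv_def isCont_def dest: has_derivative_continuous)
  then have B: "\<forall>\<^sub>F y in at x. s x / 2 < s y"
    by (rule order_tendstoD) (use pos in simp)
  \<comment> \<open>The error budget e is halved: e/2 for the linearisation of
    \<open>\<phi>\<close>, and e/2 for the numerator, whose error is divided by
    \<open>s y > s x / 2\<close>.\<close>
  have "0 < e * s x / 4" using e pos by simp
  from ev[OF this] A B show ?thesis
  proof eventually_elim
    case (elim y)
    show ?case
    proof
      assume "y \<in> S"
      have sy: "s y > 0" using elim pos by simp
      have "e * s x / 4 * norm (y - x) \<le> e / 2 * norm (y - x) * s y"
        using mult_left_mono[of "s x / 2" "s y" "e / 2 * norm (y - x)"] elim e by (simp add: mult_ac)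
      then have "g x + v \<bullet> (y - x) - e / 2 * norm (y - x) * s y \<le> g y"
        using elim \<open>y \<in> S\<close> by auto
      then have "(g x + v \<bullet> (y - x) - e / 2 * norm (y - x) * s y) / s y \<le> g y / s y"
        by (rule divide_right_mono) (use sy in simp)
      moreover have "(g x + v \<bullet> (y - x) - e / 2 * norm (y - x) * s y) / s y
          = \<phi> y - e / 2 * norm (y - x)"
        using sy by (simp only: \<phi>_def diff_divide_distrib flip: divide_inverse) simp
      ultimately have "\<phi> y - e / 2 * norm (y - x) \<le> g y / s y" by simp
      moreover have "\<phi> x + w \<bullet> (y - x) - e / 2 * norm (y - x) \<le> \<phi> y"
        using elim(2) unfolding real_norm_def inner_commute[of "y - x"] by linarith
      moreover have "\<phi> x = g x / s x" by (simp add: \<phi>_def divide_inverse)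
      ultimately show "g x / s x + w \<bullet> (y - x) - e * norm (y - x) \<le> g y / s y"
        by simp
    qed
  qed
qed

section \<open>Convergence of the scheme\<close>

theorem theorem7p9:
  fixes A :: "real ^ 'n ^ 'm" and b :: "real ^ 'm"
    and p q \<beta> L :: real
    and x :: "nat \<Rightarrow> real ^ 'n" and \<alpha> :: "nat \<Rightarrow> real"
    and \<Omega> U :: "(real ^ 'n) set"
  assumes scheme: "\<beta> > 0" "prox_linear_dinkelbach A b p q \<beta> x \<alpha>"
    and i: "feasible_set A b \<noteq> {}" "0 < p" "p \<le> 1" "q > 1" "b \<noteq> 0" "rank A = CARD('m)"
    and ii: "bounded (range x)"
    and iii: "compact \<Omega>" "open U" "convex U" "\<Omega> \<subseteq> U" "\<And>k. x k \<in> \<Omega> \<inter> feasible_set A b"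
      "\<And>y. y \<in> U \<Longrightarrow> s_fun p q differentiable (at y)"
      "\<And>y z. y \<in> U \<Longrightarrow> z \<in> U \<Longrightarrow>
         norm (grad (s_fun p q) y - grad (s_fun p q) z) \<le> L * norm (y - z)"
    and iv: "\<beta> > real CARD('n) powr (1 - p / q) * L"
  shows "\<forall>xbar. cluster_point x xbar \<longrightarrow>
    (let \<alpha>bar = lr_norm p xbar powr p / lr_norm q xbar powr p in
       0 \<in> (\<lambda>v. v - \<alpha>bar *\<^sub>R grad (s_fun p q) xbar) ` limiting_subdifferential (h_fun A b p) xbar) \<and>
    0 \<in> (\<lambda>v. (lr_norm q xbar powr p) *\<^sub>R v - (lr_norm p xbar powr p) *\<^sub>R grad (s_fun p q) xbar)
          ` limiting_subdifferential (h_fun A b p) xbar \<and>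
    limiting_critical_point (constrained_ratio A b p q) xbar"
proof (intro allI impI)
  fix xbar assume "cluster_point x xbar"
  then obtain r where r: "strict_mono r" "(x \<circ> r) \<longlonglongrightarrow> xbar"
    by (auto simp: cluster_point_def)
  define P where "P = (\<lambda>y :: real ^ 'n. lr_norm p y powr p)"
  define s where "s = (s_fun p q :: real ^ 'n \<Rightarrow> real)"
  define G where "G = grad (s_fun p q :: real ^ 'n \<Rightarrow> real)"
  define F where "F = feasible_set A b"
  define N where "N = real CARD('n) powr (1 - p / q)"
  have x\<Omega>: "x k \<in> \<Omega>" and xF: "x k \<in> F" and xU: "x k \<in> U" for k
    using iii(4,5) by (auto simp: F_def)
  \<comment> \<open>Since b is nonzero, the origin is infeasible, so every denominator on F is
    positive.\<close>
  have F0: "y \<noteq> 0" if "y \<in> F" for y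
    using that i(5) by (auto simp: F_def feasible_set_def)
  have spos: "s y > 0" if "y \<in> F" for y
    using lr_norm_pos[OF F0[OF that], of q] by (simp add: s_def s_fun_def)
  have sG: "GDERIV s y :> G y" if "y \<in> U" for y
    using GDERIV_grad[OF iii(6)[OF that]] by (simp add: s_def G_def)
  have scont: "isCont s y" if "y \<in> U" for y
    using has_derivative_continuous[OF sG[OF that, unfolded gderiv_def]] .
  have lip: "norm (G y - G z) \<le> L * norm (y - z)" if "y \<in> U" "z \<in> U" for y z
    using iii(7)[OF that] by (simp add: G_def)
  have \<alpha>: "\<alpha> k = P (x k) / s (x k)" for k
    using scheme(2) by (cases k)
      (auto simp: prox_linear_dinkelbach_def lr_ratio_def P_def s_def s_fun_def Let_def)
  have \<alpha>0: "0 \<le> \<alpha> k" and \<alpha>N: "\<alpha> k \<le> N" for k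
    using lr_norm_powr_le[of p q, OF _ _ F0[OF xF]] i spos[OF xF[of k]]
    by (auto simp: \<alpha> P_def N_def s_def s_fun_def divide_le_eq)
  have P\<alpha>: "P (x k) = \<alpha> k * s (x k)" for k
    using spos[OF xF[of k]] by (simp add: \<alpha>)

  have opt: "P (x (Suc k)) - (\<alpha> k *\<^sub>R G (x k)) \<bullet> x (Suc k) + \<beta> / 2 * (norm (x (Suc k) - x k))\<^sup>2
      \<le> P y - (\<alpha> k *\<^sub>R G (x k)) \<bullet> y + \<beta> / 2 * (norm (y - x k))\<^sup>2" if "y \<in> F" for k y
  proof -
    have "\<not> (h_fun A b p y - ereal ((\<alpha> k *\<^sub>R G (x k)) \<bullet> y) + ereal (\<beta> / 2 * (norm (y - x k))\<^sup>2)
      < h_fun A b p (x (Suc k)) - ereal ((\<alpha> k *\<^sub>R G (x k)) \<bullet> x (Suc k))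
        + ereal (\<beta> / 2 * (norm (x (Suc k) - x k))\<^sup>2))"
      using scheme(2) unfolding prox_linear_dinkelbach_def is_arg_min_def Let_def G_def by blast
    then show ?thesis
      using that xF[of "Suc k"] by (simp add: h_fun_eq F_def P_def)
  qed

  \<comment> \<open>Minus the gradient, at the new iterate, of the smooth part of the proximal
    objective. Expanding the square around that iterate turns minimality into a minorant of P on all
    of F with a quadratic error.\<close>
  define v where "v k = \<alpha> k *\<^sub>R G (x k) - \<beta> *\<^sub>R (x (Suc k) - x k)" for k
  have prox: "P (x (Suc k)) + v k \<bullet> (y - x (Suc k)) - \<beta> / 2 * (norm (y - x (Suc k)))\<^sup>2 \<le> P y"
    if "y \<in> F" for k y
  proof -
    have "\<beta> / 2 * (norm (y - x k))\<^sup>2 = \<beta> / 2 * (norm (y - x (Suc k)))\<^sup>2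
        + \<beta> / 2 * (norm (x (Suc k) - x k))\<^sup>2 + \<beta> * ((x (Suc k) - x k) \<bullet> (y - x (Suc k)))"
      by (simp add: power2_norm_eq_inner inner_diff_left inner_diff_right inner_commute algebra_simps)
    then show ?thesis
      using opt[OF that, of k] by (simp add: v_def inner_diff_left inner_diff_right algebra_simps)
  qed

  have descent: "(\<beta> - N * L) / 2 * (norm (x (Suc k) - x k))\<^sup>2
      \<le> (\<alpha> k - \<alpha> (Suc k)) * s (x (Suc k))" for k
  proof -
    let ?d = "x (Suc k) - x k"
    \<comment> \<open>The sign of L is not prescribed, but L times the step length bounds a norm.
      This permits replacing \<open>\<alpha> k\<close> by its bound N below.\<close>
    have L: "0 \<le> L * (norm ?d)\<^sup>2"
      using order_trans[OF norm_ge_zero lip[OF xU xU, of "Suc k" k]]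
      by (simp add: power2_eq_square mult_nonneg_nonneg flip: mult.assoc)
    have "\<alpha> k * (s (x k) + G (x k) \<bullet> ?d - L / 2 * (norm ?d)\<^sup>2) \<le> \<alpha> k * s (x (Suc k))"
      using quadratic_lower_bound_of_Lipschitz_gradient[OF iii(3) xU xU sG lip] \<alpha>0
      by (intro mult_left_mono) auto
    moreover have "\<alpha> k * (L * (norm ?d)\<^sup>2) \<le> N * (L * (norm ?d)\<^sup>2)"
      using \<alpha>N L by (rule mult_right_mono)
    \<comment> \<open>The previous iterate is the competitor. With \<open>P\<alpha>\<close>, the
      terms in \<open>s (x k)\<close> cancel when the three inequalities are combined.\<close>
    moreover have "P (x (Suc k)) + \<beta> / 2 * (norm ?d)\<^sup>2 \<le> P (x k) + \<alpha> k * (G (x k) \<bullet> ?d)"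
      using opt[OF xF, of k k] by (simp add: inner_diff_right algebra_simps)
    ultimately show ?thesis
      by (simp add: P\<alpha> diff_divide_distrib algebra_simps)
  qed

  \<comment> \<open>Monotone ratios and vanishing steps\<close>
  have "continuous_on \<Omega> s"
    using scont iii(4) by (intro continuous_at_imp_continuous_on) auto
  then have "bounded (s ` \<Omega>)"
    using iii(1) compact_continuous_image compact_imp_bounded by blast
  then obtain M where M: "\<And>y. y \<in> \<Omega> \<Longrightarrow> s y \<le> M"
    by (auto simp: bounded_real abs_le_iff)
  have \<kappa>: "\<beta> - N * L > 0" using iv by (simp add: N_def)
  have dec: "\<alpha> (Suc k) \<le> \<alpha> k" for k
  proof -
    have "0 \<le> (\<alpha> k - \<alpha> (Suc k)) * s (x (Suc k))"
      by (rule order_trans[OF _ descent]) (use \<kappa> in simp)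
    then show ?thesis using spos[OF xF[of "Suc k"]] by (simp add: zero_le_mult_iff)
  qed
  have steps: "(\<lambda>k. x (Suc k) - x k) \<longlonglongrightarrow> 0"
  proof -
    obtain a where a: "\<alpha> \<longlonglongrightarrow> a"
      using decseq_convergent[OF decseq_SucI[of \<alpha>, OF dec]] \<alpha>0 by blast
    have "(\<lambda>k. (\<alpha> k - \<alpha> (Suc k)) * (2 * M / (\<beta> - N * L))) \<longlonglongrightarrow> (a - a) * (2 * M / (\<beta> - N * L))"
      by (intro tendsto_intros a LIMSEQ_Suc)
    then have lim: "(\<lambda>k. (\<alpha> k - \<alpha> (Suc k)) * (2 * M / (\<beta> - N * L))) \<longlonglongrightarrow> 0" by simp
    \<comment> \<open>The factor comes from solving \<open>descent\<close> for the squared step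
      after bounding s by M. The differences of the convergent sequence \<open>\<alpha>\<close> tend
      to 0.\<close>
    have "(norm (x (Suc k) - x k))\<^sup>2 \<le> (\<alpha> k - \<alpha> (Suc k)) * (2 * M / (\<beta> - N * L))" for k
    proof -
      have "(\<alpha> k - \<alpha> (Suc k)) * s (x (Suc k)) \<le> (\<alpha> k - \<alpha> (Suc k)) * M"
        using dec[of k] M[OF x\<Omega>] by (intro mult_left_mono) auto
      with descent[of k] show ?thesis using \<kappa> by (simp add: field_simps)
    qed
    then have "(\<lambda>k. (norm (x (Suc k) - x k))\<^sup>2) \<longlonglongrightarrow> 0"
      by (intro tendsto_sandwich[OF _ _ tendsto_const lim]) auto
    then have "(\<lambda>k. sqrt ((norm (x (Suc k) - x k))\<^sup>2)) \<longlonglongrightarrow> sqrt 0"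
      by (rule tendsto_real_sqrt)
    then show ?thesis by (simp add: tendsto_norm_zero_iff)
  qed

  \<comment> \<open>Limits along the subsequence\<close>
  have xbF: "xbar \<in> F"
    using closed_sequentially[OF closed_feasible_set _ r(2), of A b] xF by (auto simp: F_def)
  \<comment> \<open>Compactness of \<open>\<Omega>\<close> keeps the limit inside the open set U,
    where s is differentiable.\<close>
  have xbU: "xbar \<in> U"
    using closed_sequentially[OF compact_imp_closed[OF iii(1)] _ r(2)] x\<Omega> iii(4) by auto
  have x0: "(\<lambda>j. x (r j)) \<longlonglongrightarrow> xbar" using r(2) by (simp add: o_def)
  have d0: "(\<lambda>j. x (Suc (r j)) - x (r j)) \<longlonglongrightarrow> 0"
    using LIMSEQ_subseq_LIMSEQ[OF steps r(1)] by (simp add: o_def)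
  \<comment> \<open>The subgradients \<open>v k\<close> live at the iterate with index
    \<open>Suc k\<close>, so the shifted subsequence must have the same limit.\<close>
  have x1: "(\<lambda>j. x (Suc (r j))) \<longlonglongrightarrow> xbar"
    using tendsto_add[OF d0 x0] by simp
  have Plim: "(\<lambda>j. P (f j)) \<longlonglongrightarrow> P xbar" if "f \<longlonglongrightarrow> xbar" for f
    unfolding P_def using i(2) that by (rule tendsto_lr_norm_powr_self)
  have slim: "(\<lambda>j. s (f j)) \<longlonglongrightarrow> s xbar" if "f \<longlonglongrightarrow> xbar" for f
    using scont[OF xbU] that by (rule isCont_tendsto_compose)
  have Glim: "(\<lambda>j. G (f j)) \<longlonglongrightarrow> G xbar" if f: "f \<longlonglongrightarrow> xbar" "\<And>j. f j \<in> U" for f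
  proof -
    have "(\<lambda>j. L * norm (f j - xbar)) \<longlonglongrightarrow> L * norm (xbar - xbar)"
      by (intro tendsto_intros f)
    then have "(\<lambda>j. G (f j) - G xbar) \<longlonglongrightarrow> 0"
      by (intro Lim_null_comparison[of "\<lambda>j. G (f j) - G xbar" "\<lambda>j. L * norm (f j - xbar)"])
        (auto intro!: always_eventually lip f xbU)
    then show ?thesis by (simp add: LIM_zero_iff)
  qed
  define a where "a = P xbar / s xbar"
  have "(\<lambda>j. \<alpha> (r j)) \<longlonglongrightarrow> a"
    unfolding \<alpha> a_def using spos[OF xbF] by (intro tendsto_divide Plim slim x0) simp
  then have "(\<lambda>j. v (r j)) \<longlonglongrightarrow> a *\<^sub>R G xbar - \<beta> *\<^sub>R 0"
    unfolding v_def by (intro tendsto_intros Glim x0 xU d0)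
  then have vlim: "(\<lambda>j. v (r j)) \<longlonglongrightarrow> a *\<^sub>R G xbar" by simp

  have reg: "\<forall>\<^sub>F y in at (x (Suc k)). y \<in> F \<longrightarrow>
      P (x (Suc k)) + v k \<bullet> (y - x (Suc k)) - e * norm (y - x (Suc k)) \<le> P y" if "e > 0" for e k
  proof -
    \<comment> \<open>Within radius \<open>2 * e / \<beta>\<close> the quadratic error in
      \<open>prox\<close> is at most e times the distance.\<close>
    have "\<forall>\<^sub>F y in at (x (Suc k)). dist y (x (Suc k)) < 2 * e / \<beta>"
      unfolding eventually_at using that scheme(1) by (intro exI[of _ "2 * e / \<beta>"]) auto
    then show ?thesis
    proof eventually_elim
      case (elim y)
      then have "\<beta> / 2 * norm (y - x (Suc k)) \<le> e"
        using scheme(1) by (simp add: dist_norm field_simps)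
      then have "\<beta> / 2 * norm (y - x (Suc k)) * norm (y - x (Suc k)) \<le> e * norm (y - x (Suc k))"
        by (rule mult_right_mono) simp
      then show ?case using prox[of y k] by (auto simp: power2_eq_square)
    qed
  qed

  have heq: "h_fun A b p = (\<lambda>y. if y \<in> F then ereal (P y) else \<infinity>)"
    unfolding h_fun_eq F_def P_def ..
  have hreg: "v k \<in> regular_subdifferential (h_fun A b p) (x (Suc k))" for k
    unfolding heq using xF reg by (rule regular_subdifferential_restrictI)
  have hlim: "(\<lambda>j. h_fun A b p (x (Suc (r j)))) \<longlonglongrightarrow> h_fun A b p xbar"
    using xF xbF Plim[OF x1] by (simp add: heq)
  have hdom: "xbar \<in> eff_domain (h_fun A b p)"
    using xbF by (simp add: eff_domain_def heq)
  have h: "a *\<^sub>R G xbar \<in> limiting_subdifferential (h_fun A b p) xbar"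
    using hdom x1 hlim hreg vlim by (rule limiting_subdifferentialI)

  \<comment> \<open>Criticality of the ratio\<close>
  define w where "w k = (1 / s (x (Suc k))) *\<^sub>R
    (v k - (P (x (Suc k)) / s (x (Suc k))) *\<^sub>R G (x (Suc k)))" for k
  \<comment> \<open>Both terms in the bracket tend to the same multiple of \<open>G xbar\<close>,
    since \<open>a\<close> is by definition the ratio at \<open>xbar\<close>; hence they
    cancel.\<close>
  have "(\<lambda>j. w (r j)) \<longlonglongrightarrow> (1 / s xbar) *\<^sub>R (a *\<^sub>R G xbar - (P xbar / s xbar) *\<^sub>R G xbar)"
    unfolding w_def using spos[OF xbF]
    by (intro tendsto_intros Plim slim Glim x1 vlim xU) simp_all
  then have wlim: "(\<lambda>j. w (r j)) \<longlonglongrightarrow> 0" by (simp add: a_def)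
  have cr: "constrained_ratio A b p q = (\<lambda>y. if y \<in> F then ereal (P y / s y) else \<infinity>)"
    by (simp add: fun_eq_iff constrained_ratio_def F_def lr_ratio_def P_def s_def s_fun_def)
  have wreg: "w k \<in> regular_subdifferential (constrained_ratio A b p q) (x (Suc k))" for k
    unfolding cr w_def
    by (rule regular_subdifferential_restrictI[OF xF])
      (rule regular_subgradient_quotient[OF reg sG[OF xU] spos[OF xF]])
  have "(\<lambda>j. P (x (Suc (r j))) / s (x (Suc (r j)))) \<longlonglongrightarrow> P xbar / s xbar"
    using spos[OF xbF] by (intro tendsto_divide Plim slim x1) simp
  then have crlim: "(\<lambda>j. constrained_ratio A b p q (x (Suc (r j)))) \<longlonglongrightarrow> constrained_ratio A b p q xbar"
    using xF xbF by (simp add: cr)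
  have dom: "xbar \<in> eff_domain (constrained_ratio A b p q)"
    using xbF by (simp add: eff_domain_def cr)
  have crit: "limiting_critical_point (constrained_ratio A b p q) xbar"
    unfolding limiting_critical_point_def
    using dom limiting_subdifferentialI[OF dom x1 crlim wreg wlim] ..

  have sa: "s xbar *\<^sub>R (a *\<^sub>R G xbar) = P xbar *\<^sub>R G xbar"
    using spos[OF xbF] by (simp add: a_def)
  show "(let \<alpha>bar = lr_norm p xbar powr p / lr_norm q xbar powr p in
       0 \<in> (\<lambda>v. v - \<alpha>bar *\<^sub>R grad (s_fun p q) xbar) ` limiting_subdifferential (h_fun A b p) xbar) \<and>
    0 \<in> (\<lambda>v. (lr_norm q xbar powr p) *\<^sub>R v - (lr_norm p xbar powr p) *\<^sub>R grad (s_fun p q) xbar)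
          ` limiting_subdifferential (h_fun A b p) xbar \<and>
    limiting_critical_point (constrained_ratio A b p q) xbar"
    unfolding Let_def
  \<comment> \<open>The same limiting subgradient \<open>a *\<^sub>R G xbar\<close> of h witnesses
    both inclusions; the second is the first multiplied by \<open>s xbar\<close>.\<close>
  proof (intro conjI crit image_eqI[OF _ h])
    show "0 = a *\<^sub>R G xbar - (lr_norm p xbar powr p / lr_norm q xbar powr p) *\<^sub>R grad (s_fun p q) xbar"
      by (simp add: a_def P_def s_def s_fun_def G_def)
    show "0 = lr_norm q xbar powr p *\<^sub>R (a *\<^sub>R G xbar) -
        lr_norm p xbar powr p *\<^sub>R grad (s_fun p q) xbar"
      using sa by (simp add: P_def s_def s_fun_def G_def)
  qed
qed

end
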